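(* Let $X,Y$ be metric spaces, $(\bar x,\bar y)\in X\times Y$, and let $f:X\times Y\to\mathbb{R}\cup\{+\infty\}$ satisfy $f(\bar x,\bar y)=0$ and the conditions (P1), (P2) recalled in the context. Then: (i) $\mathrm{Er}\, f(\bar x,\bar y)\le \overline{|\nabla f|}{}^{\diamond}(\bar x,\bar y)$; (ii) if $X$ and $Y$ are complete and $f_+$ is lower semicontinuous (in the product topology) near $(\bar x,\bar y)$, then $\mathrm{Er}\, f(\bar x,\bar y)= \overline{|\nabla f|}{}^{\diamond}(\bar x,\bar y)$.
   Context: All metrics are denoted by $d$. For $\alpha\in\mathbb{R}\cup\{+\infty\}$, $\alpha_+:=\max\{\alpha,0\}$; $f_+(x,y):=(f(x,y))_+$. Conventions: $\inf\emptyset=+\infty$; $c/0=+\infty$ for $c\in(0,+\infty]$. (P1) $f(x,y)>0$ whenever $y\ne\bar y$. (P2) $\liminf_{f(x,y)\downarrow 0}\frac{f(x,y)}{d(y,\bar y)}>0$ (the lower limit over all $(x,y)\in X\times Y$ with $f(x,y)>0$, as $f(x,y)\to0$). $S(f):=\{x\in X\mid f(x,y)\le 0\text{ for some }y\in Y\}$, and $$\mathrm{Er}\, f(\bar x,\bar y):=\liminf_{x\to\bar x,\ f(x,y)>0}\frac{f(x,y)}{d(x,S(f))}$$ (lower limit over pairs $(x,y)\in X\times Y$ with $f(x,y)>0$, as $x\to\bar x$, with no restriction on $y$). For $\rho>0$, $d_\rho((x,y),(u,v)):=\max\{d(x,u),\rho\, d(y,v)\}$. For $f(x,y)<\infty$,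 the nonlocal $\rho$-slope is $$|\nabla f|^{\diamond}_\rho(x,y):=\sup_{(u,v)\ne(x,y)}\frac{[f(x,y)-f_+(u,v)]_+}{d_\rho((x,y),(u,v))},$$ and the uniform strict slope of $f$ at $(\bar x,\bar y)$ is $$\overline{|\nabla f|}{}^{\diamond}(\bar x,\bar y):=\lim_{\rho\downarrow0}\ \inf_{d(x,\bar x)<\rho,\ 0<f(x,y)<\rho}|\nabla f|^{\diamond}_\rho(x,y).$$ *)

theory Defs
  imports "HOL-Analysis.Analysis"
begin

(* Extended-real division satisfies c / 0 = \<infinity> for c > 0 (including c = \<infinity>), and
   infima and lower limits over empty sets are \<infinity>. *)

definition zero_sublevel :: "('a \<times> 'b \<Rightarrow> ereal) \<Rightarrow> 'a set" where
  "zero_sublevel f = {x. \<exists>y. f (x, y) \<le> 0}"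

(* As x \<rightarrow> xb, the value x = xb is not excluded.  Excluding it would make no difference when
   xb \<in> zero_sublevel f, since the quotient is then \<infinity> at x = xb.  infdist differs from the
   usual distance only for the empty set, where it is 0 instead of \<infinity>. *)
definition error_bound_modulus ::
    "('a::metric_space \<times> 'b::metric_space \<Rightarrow> ereal) \<Rightarrow> 'a \<times> 'b \<Rightarrow> ereal" where
  "error_bound_modulus f pb =
     Liminf (inf (filtercomap fst (nhds (fst pb))) (principal {p. f p > 0}))
       (\<lambda>p. f p / ereal (infdist (fst p) (zero_sublevel f)))"

definition dist_rho ::
    "real \<Rightarrow> 'a::metric_space \<times> 'b::metric_space \<Rightarrow> 'a \<times> 'b \<Rightarrow> real" where
  "dist_rho \<rho> p q = max (dist (fst p) (fst q)) (\<rho> * dist (snd p) (snd q))"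

(* Meaningful for f p < \<infinity> only.  If the product space is a single point, the supremum is
   -\<infinity>. *)
definition nonlocal_slope ::
    "real \<Rightarrow> ('a::metric_space \<times> 'b::metric_space \<Rightarrow> ereal) \<Rightarrow> 'a \<times> 'b \<Rightarrow> ereal" where
  "nonlocal_slope \<rho> f p =
     (SUP q \<in> {q. q \<noteq> p}. max (f p - max (f q) 0) 0 / ereal (dist_rho \<rho> p q))"

definition inf_nonlocal_slope ::
    "('a::metric_space \<times> 'b::metric_space \<Rightarrow> ereal) \<Rightarrow> 'a \<times> 'b \<Rightarrow> real \<Rightarrow> ereal" where
  "inf_nonlocal_slope f pb \<rho> =
     (INF p \<in> {p. dist (fst p) (fst pb) < \<rho> \<and> 0 < f p \<and> f p < ereal \<rho>}. nonlocal_slope \<rho> f p)"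

definition uniform_strict_slope ::
    "('a::metric_space \<times> 'b::metric_space \<Rightarrow> ereal) \<Rightarrow> 'a \<times> 'b \<Rightarrow> ereal" where
  "uniform_strict_slope f pb = Lim (at_right 0) (inf_nonlocal_slope f pb)"

definition lsc_at :: "('a::topological_space \<Rightarrow> ereal) \<Rightarrow> 'a \<Rightarrow> bool" where
  "lsc_at h p \<longleftrightarrow> h p \<le> Liminf (at p) h"

definition cond_P1 :: "('a \<times> 'b \<Rightarrow> ereal) \<Rightarrow> 'b \<Rightarrow> bool" where
  "cond_P1 f yb \<longleftrightarrow> (\<forall>x y. y \<noteq> yb \<longrightarrow> f (x, y) > 0)"

definition cond_P2 :: "('a \<times> 'b::metric_space \<Rightarrow> ereal) \<Rightarrow> 'b \<Rightarrow> bool" where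
  "cond_P2 f yb \<longleftrightarrow>
     Liminf (filtercomap f (at_right 0)) (\<lambda>p. f p / ereal (dist (snd p) yb)) > 0"

(* The limit defining the uniform strict slope always exists, by monotonicity. *)

lemma dist_rho_mono: "\<rho> \<le> \<sigma> \<Longrightarrow> dist_rho \<rho> p q \<le> dist_rho \<sigma> p q"
  unfolding dist_rho_def by (intro max.mono mult_right_mono) auto

lemma dist_rho_pos: "0 < \<rho> \<Longrightarrow> p \<noteq> q \<Longrightarrow> 0 < dist_rho \<rho> p q"
  by (cases "fst p = fst q") (auto simp: dist_rho_def less_max_iff_disj prod_eq_iff)

lemma nonlocal_slope_antimono:
  assumes "0 < \<rho>" "\<rho> \<le> \<sigma>"
  shows "nonlocal_slope \<sigma> f p \<le> nonlocal_slope \<rho> f p"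
  unfolding nonlocal_slope_def
proof (rule SUP_subset_mono[OF order_refl])
  fix q assume "q \<in> {q. q \<noteq> p}"
  then have pos: "0 < dist_rho \<rho> p q"
    by (intro dist_rho_pos[OF assms(1)]) (metis mem_Collect_eq)
  have le: "dist_rho \<rho> p q \<le> dist_rho \<sigma> p q"
    by (rule dist_rho_mono[OF assms(2)])
  have "inverse (ereal (dist_rho \<sigma> p q)) \<le> inverse (ereal (dist_rho \<rho> p q))"
    using pos le by (intro ereal_inverse_antimono) simp_all
  then show "max (f p - max (f q) 0) 0 / ereal (dist_rho \<sigma> p q)
      \<le> max (f p - max (f q) 0) 0 / ereal (dist_rho \<rho> p q)"
    unfolding divide_ereal_def by (rule ereal_mult_left_mono) (rule max.cobounded2)
qed

lemma inf_nonlocal_slope_antimono: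
  assumes "0 < \<rho>" "\<rho> \<le> \<sigma>"
  shows "inf_nonlocal_slope f pb \<sigma> \<le> inf_nonlocal_slope f pb \<rho>"
  unfolding inf_nonlocal_slope_def
proof (rule INF_mono)
  fix p assume p: "p \<in> {p. dist (fst p) (fst pb) < \<rho> \<and> 0 < f p \<and> f p < ereal \<rho>}"
  have "f p < ereal \<sigma>" using p assms(2) less_le_trans[of "f p" "ereal \<rho>" "ereal \<sigma>"] by simp
  then show "\<exists>q\<in>{p. dist (fst p) (fst pb) < \<sigma> \<and> 0 < f p \<and> f p < ereal \<sigma>}.
      nonlocal_slope \<sigma> f q \<le> nonlocal_slope \<rho> f p"
    using p assms nonlocal_slope_antimono[OF assms, of f p] by (intro bexI[of _ p]) auto
qed

lemma tendsto_uniform_strict_slope: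
  "(inf_nonlocal_slope f pb \<longlongrightarrow> uniform_strict_slope f pb) (at_right 0)"
proof -
  let ?g = "inf_nonlocal_slope f pb"
  have "(?g \<longlongrightarrow> (SUP \<rho>\<in>{0<..}. ?g \<rho>)) (at_right 0)"
  proof (rule order_tendstoI)
    fix a assume "a < (SUP \<rho>\<in>{0<..}. ?g \<rho>)"
    then obtain r where "0 < r" "a < ?g r" by (auto simp: less_SUP_iff)
    then show "eventually (\<lambda>\<rho>. a < ?g \<rho>) (at_right 0)"
      unfolding eventually_at_right_field
      by (meson inf_nonlocal_slope_antimono less_imp_le less_le_trans)
  next
    fix a assume "(SUP \<rho>\<in>{0<..}. ?g \<rho>) < a"
    moreover have "?g \<rho> \<le> (SUP \<rho>\<in>{0<..}. ?g \<rho>)" if "0 < \<rho>" for \<rho>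
      using that by (intro SUP_upper) auto
    ultimately show "eventually (\<lambda>\<rho>. ?g \<rho> < a) (at_right 0)"
      unfolding eventually_at_right_field by (meson le_less_trans zero_less_one)
  qed
  then show ?thesis
    unfolding uniform_strict_slope_def using tendsto_Lim trivial_limit_at_right_real by metis
qed

end

theory Submission
  imports Defs
begin

text \<open>
  If \<open>Er f > c\<close>, then every \<open>p = (x, y)\<close> with \<open>x\<close> near \<open>xb\<close> and \<open>f p > 0\<close> small admits a point
  \<open>u\<close> of the solution set with \<open>c d(x, u) < f p\<close>.  By (P1) the zero of \<open>f\<close> above \<open>u\<close> is \<open>(u, yb)\<close>,
  and by (P2) the distance \<open>d(y, yb)\<close> is at most a multiple of \<open>f p\<close>, so for small \<open>\<rho>\<close> the point
  \<open>(u, yb)\<close> shows that the slope at \<open>p\<close> is at least \<open>c\<close>.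

  Conversely, if \<open>Er f < c\<close>, then there are points \<open>p = (x, y)\<close> with \<open>x\<close> arbitrarily close to \<open>xb\<close> and
  \<open>0 < f p < c d(x, S(f))\<close>.  By (P2) such a point lies close to \<open>(xb, yb)\<close>.  Ekeland's principle for
  \<open>f\<^sub>+\<close> and the metric \<open>d\<^sub>\<rho>\<close> on a small closed box gives \<open>q\<close> near \<open>p\<close> from which \<open>f\<^sub>+\<close> does not
  decrease faster than \<open>c\<close> inside the box; outside the box the distance to \<open>q\<close> is too large compared
  with \<open>f q\<close>.  As \<open>q\<close> is closer to \<open>p\<close> than \<open>d(x, S(f))\<close>, it satisfies \<open>f q > 0\<close>, and the slope
  there is at most \<open>c\<close>.
\<close>

section \<open>Ekeland's variational principle in a complete metric space\<close>

text \<open>Moving from x only to points where g has dropped at rate at least c gives a preorder. A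
  descending sequence that almost minimizes g at each step is Cauchy, because its steps are bounded
  by decrements of g. Anything below its limit q is below every term, and near-minimality squeezes
  it onto q.\<close>

lemma (in Metric_space) ekeland_variational_principle:
  fixes g :: "'a \<Rightarrow> ereal"
  assumes complete: mcomplete
    and c: "0 < c"
    and g_nonneg: "\<And>x. x \<in> M \<Longrightarrow> 0 \<le> g x"
    and lsc: "\<And>\<sigma> x a. limitin mtopology \<sigma> x sequentially \<Longrightarrow> range \<sigma> \<subseteq> M \<Longrightarrow> a < g x \<Longrightarrow>
                eventually (\<lambda>n. a < g (\<sigma> n)) sequentially"
    and p: "p \<in> M" "g p < \<infinity>"
  obtains q where "q \<in> M" "g q + ereal (c * d p q) \<le> g p"
    "\<And>x. x \<in> M \<Longrightarrow> x \<noteq> q \<Longrightarrow> g q < g x + ereal (c * d q x)"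
proof -
  \<comment> \<open>The last claim about q says exactly that \<open>T q\<close> has no element other
    than q.\<close>
  define T where "T x = {y \<in> M. g y + ereal (c * d x y) \<le> g x}" for x
  have T_refl: "x \<in> T x" if "x \<in> M" for x
    using that by (auto simp: T_def)
  have T_le: "g y \<le> g x" if "y \<in> T x" for x y
  proof -
    have "g y + 0 \<le> g y + ereal (c * d x y)"
      using c by (intro add_left_mono) auto
    with that show ?thesis by (auto simp: T_def)
  qed
  have T_trans: "z \<in> T x" if "x \<in> M" "y \<in> T x" "z \<in> T y" for x y z
  proof -
    have "d x z \<le> d x y + d y z"
      using that by (intro triangle) (auto simp: T_def)
    then have "c * d x z \<le> c * d y z + c * d x y"
      using c by (simp add: distrib_left[symmetric])
    then have "g z + ereal (c * d x z) \<le> g z + (ereal (c * d y z) + ereal (c * d x y))"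
      by (intro add_left_mono) simp
    also have "\<dots> \<le> g y + ereal (c * d x y)"
      unfolding add.assoc[symmetric] using that(3) by (intro add_right_mono) (simp add: T_def)
    also have "\<dots> \<le> g x"
      using that by (auto simp: T_def)
    finally show ?thesis using that by (auto simp: T_def)
  qed
  have step: "\<exists>y. y \<in> T x \<and> (\<forall>z\<in>T x. g y \<le> g z + ereal \<epsilon>)"
    if x: "x \<in> M" "g x < \<infinity>" and "0 < \<epsilon>" for x \<epsilon>
  proof -
    define i where "i = (INF z\<in>T x. g z)"
    have "0 \<le> i"
      unfolding i_def using g_nonneg by (intro INF_greatest) (auto simp: T_def)
    moreover have "i \<le> g x"
      unfolding i_def using T_refl x by (intro INF_lower) auto
    \<comment> \<open>Finiteness of \<open>i\<close> makes \<open>i + ereal \<epsilon>\<close>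
      strictly larger, so some value of g on \<open>T x\<close> lies below it.\<close>
    ultimately have "\<bar>i\<bar> \<noteq> \<infinity>" using x by auto
    then have "i < i + ereal \<epsilon>" using \<open>0 < \<epsilon>\<close> by (cases i) auto
    then obtain y where "y \<in> T x" "g y < i + ereal \<epsilon>"
      by (auto simp: i_def INF_less_iff)
    moreover have "i + ereal \<epsilon> \<le> g z + ereal \<epsilon>" if "z \<in> T x" for z
      unfolding i_def using that by (intro add_right_mono INF_lower)
    ultimately show ?thesis by (meson less_imp_le order_trans)
  qed
  \<comment> \<open>Keeping \<open>s n\<close> in \<open>T p\<close> keeps g finite along the
    sequence, which \<open>step\<close> requires; the clause for n = 0 fixes the starting
    point.\<close>
  have "\<exists>s. \<forall>n. (s n \<in> T p \<and> (n = 0 \<longrightarrow> s n = p)) \<and>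
      (s (Suc n) \<in> T (s n) \<and> (\<forall>z\<in>T (s n). g (s (Suc n)) \<le> g z + ereal (inverse (real (Suc n)))))"
  proof (rule dependent_nat_choice)
    show "\<exists>x. x \<in> T p \<and> (0 = 0 \<longrightarrow> x = p)" using T_refl p by auto
  next
    fix x and n :: nat assume x: "x \<in> T p \<and> (n = 0 \<longrightarrow> x = p)"
    then have "x \<in> M" "g x < \<infinity>" using T_le[of x p] p by (auto simp: T_def)
    from step[OF this, of "inverse (real (Suc n))"]
    show "\<exists>y. (y \<in> T p \<and> (Suc n = 0 \<longrightarrow> y = p)) \<and> y \<in> T x \<and>
        (\<forall>z\<in>T x. g y \<le> g z + ereal (inverse (real (Suc n))))"
      using T_trans[of p x] x p by auto
  qed
  then obtain s where sT: "\<And>n. s n \<in> T p" and s_Suc: "\<And>n. s (Suc n) \<in> T (s n)"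
    and s_min: "\<And>n z. z \<in> T (s n) \<Longrightarrow> g (s (Suc n)) \<le> g z + ereal (inverse (real (Suc n)))"
    and s0: "s 0 = p"
    by blast
  have sM: "s n \<in> M" for n using sT[of n] by (auto simp: T_def)
  define h where "h n = real_of_ereal (g (s n))" for n
  have gs: "g (s n) = ereal (h n)" and h_nonneg: "0 \<le> h n" for n
  proof -
    have "g (s n) < \<infinity>" "0 \<le> g (s n)"
      using le_less_trans[OF T_le[OF sT[of n]] p(2)] g_nonneg[OF sM[of n]] by simp_all
    then show "g (s n) = ereal (h n)" "0 \<le> h n" unfolding h_def by (cases "g (s n)"; auto)+
  qed
  have s_le: "s n \<in> T (s m)" if "m \<le> n" for m n
    using that
  proof (induction n rule: dec_induct)
    case base
    show ?case by (rule T_refl[OF sM])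
  next
    case (step n)
    show ?case by (rule T_trans[OF sM step.IH s_Suc])
  qed
  have s_dist: "c * d (s m) (s n) \<le> h m - h n" if "m \<le> n" for m n
    using s_le[OF that] by (auto simp: T_def gs)
  have "decseq h"
    using T_le[OF s_Suc] by (intro decseq_SucI) (simp add: gs)
  then have "convergent h"
    using h_nonneg decseq_convergent[of h 0] convergentI by blast
  then have "Cauchy h" by (rule convergent_Cauchy)
  have "MCauchy s"
    unfolding MCauchy_def
  proof (intro conjI allI impI)
    show "range s \<subseteq> M" using sM by auto
    fix \<epsilon> :: real assume "0 < \<epsilon>"
    with c have "0 < c * \<epsilon>" by simp
    from CauchyD[OF \<open>Cauchy h\<close> this] obtain N
      where N: "\<And>m n. N \<le> m \<Longrightarrow> N \<le> n \<Longrightarrow> norm (h m - h n) < c * \<epsilon>" by blast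
    have *: "d (s m) (s n) < \<epsilon>" if "N \<le> m" "m \<le> n" for m n
    proof -
      have "c * d (s m) (s n) < c * \<epsilon>" using s_dist[of m n] N[of m n] that by simp
      then show ?thesis using c by simp
    qed
    have "d (s m) (s n) < \<epsilon>" if "N \<le> m" "N \<le> n" for m n
      using *[of m n] *[of n m] that commute[of "s m" "s n"] by (cases "m \<le> n") auto
    then show "\<exists>N. \<forall>n n'. N \<le> n \<longrightarrow> N \<le> n' \<longrightarrow> d (s n) (s n') < \<epsilon>" by blast
  qed
  with complete obtain q where lim: "limitin mtopology s q sequentially"
    unfolding mcomplete_def by blast
  then have qM: "q \<in> M" by (simp add: limitin_metric)
  have dq: "(\<lambda>n. d (s n) q) \<longlonglongrightarrow> 0"
    using lim sM by (simp add: limitin_metric_dist_null)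
  \<comment> \<open>For a < g q, lower semicontinuity puts a below g (s n) for large n, and the
    telescoped decrease from s m to s n bounds this value. Letting n tend to infinity and then a
    tend to g q gives the claim.\<close>
  have q_le: "q \<in> T (s m)" for m
  proof -
    have "a \<le> ereal (h m - c * d (s m) q)" if "a < g q" for a
    proof (rule tendsto_lowerbound[where F = sequentially])
      have "(\<lambda>n. h m - c * d (s m) q + c * d (s n) q) \<longlonglongrightarrow> h m - c * d (s m) q + c * 0"
        by (intro tendsto_intros dq)
      then show "(\<lambda>n. ereal (h m - c * d (s m) q + c * d (s n) q)) \<longlonglongrightarrow> ereal (h m - c * d (s m) q)"
        by simp
      have "eventually (\<lambda>n. a < g (s n)) sequentially"
        using lsc[OF lim _ that] sM by auto
      then show "eventually (\<lambda>n. a \<le> ereal (h m - c * d (s m) q + c * d (s n) q)) sequentially"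
        using eventually_ge_at_top[of m]
      proof eventually_elim
        case (elim n)
        have "d (s m) q \<le> d (s m) (s n) + d (s n) q"
          using sM qM by (intro triangle)
        then have "c * d (s m) q \<le> c * d (s m) (s n) + c * d (s n) q"
          using c by (simp add: distrib_left[symmetric])
        with s_dist[OF elim(2)] have "h n \<le> h m - c * d (s m) q + c * d (s n) q" by simp
        with elim(1) show ?case by (metis gs ereal_less_eq(3) less_imp_le order_trans)
      qed
    qed simp
    then have "g q \<le> ereal (h m - c * d (s m) q)" by (rule dense_le)
    then show ?thesis using qM by (cases "g q") (auto simp: T_def gs)
  qed
  show ?thesis
  proof
    show "q \<in> M" by (rule qM)
    show "g q + ereal (c * d p q) \<le> g p" using q_le[of 0] by (simp add: T_def s0)
    fix x assume x: "x \<in> M" "x \<noteq> q"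
    show "g q < g x + ereal (c * d q x)"
    proof (rule ccontr)
      assume "\<not> ?thesis"
      then have "x \<in> T q" using x by (auto simp: T_def)
      then have xT: "x \<in> T (s n)" for n using T_trans[OF sM q_le] by blast
      \<comment> \<open>As x lies in \<open>T (s (Suc n))\<close>, g x is smaller than g (s (Suc n))
        by at least c times the distance; as x lies in \<open>T (s n)\<close>, it is smaller by at
        most 1 / (n + 1).\<close>
      have "d (s (Suc n)) x \<le> inverse (real (Suc n)) / c" for n
      proof -
        have "c * d (s (Suc n)) x \<le> inverse (real (Suc n))"
          using xT[of "Suc n"] s_min[OF xT, of n] by (cases "g x") (auto simp: T_def gs)
        then show ?thesis using c by (simp only: pos_le_divide_eq mult.commute)
      qed
      moreover have "(\<lambda>n. inverse (real (Suc n)) / c) \<longlonglongrightarrow> 0 / c"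
        using c by (intro tendsto_divide tendsto_const LIMSEQ_inverse_real_of_nat) simp
      ultimately have "(\<lambda>n. d (s (Suc n)) x) \<longlonglongrightarrow> 0"
        using tendsto_sandwich[OF always_eventually always_eventually tendsto_const,
            of 0 "\<lambda>n. d (s (Suc n)) x" "\<lambda>n. inverse (real (Suc n)) / c"]
        by (simp only: div_0 nonneg simp_thms)
      then have "(\<lambda>n. d (s n) x) \<longlonglongrightarrow> 0" by (rule LIMSEQ_imp_Suc)
      then have "limitin mtopology s x sequentially"
        using x sM by (simp add: limitin_metric_dist_null)
      with lim have "q = x" by (rule limitin_metric_unique) simp
      with x(2) show False by simp
    qed
  qed
qed

text \<open>Clears the denominators of Er f and (P2). Both sides hold when s = 0, since F / 0 =
  \<infinity>, so points at distance zero need no separate treatment later.\<close>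

lemma ereal_less_divide_iff:
  assumes "0 < F" "0 \<le> s"
  shows "ereal c < F / ereal s \<longleftrightarrow> ereal (c * s) < F"
proof (cases "s = 0")
  case True
  with assms show ?thesis by (cases F) (auto simp: divide_ereal_def)
next
  case False
  with assms show ?thesis by (cases F) (auto simp: field_simps)
qed

section \<open>The metric \<open>dist_rho\<close> on products\<close>

lemma dist_rho_triangle:
  assumes "0 < \<rho>"
  shows "dist_rho \<rho> p r \<le> dist_rho \<rho> p q + dist_rho \<rho> q r"
proof -
  have "\<rho> * dist (snd p) (snd r) \<le> \<rho> * dist (snd p) (snd q) + \<rho> * dist (snd q) (snd r)"
    using assms by (simp add: distrib_left[symmetric] dist_triangle)
  then show ?thesis
    using dist_triangle[of "fst p" "fst r" "fst q"] unfolding dist_rho_def by linarith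
qed

lemma dist_rho_commute: "dist_rho \<rho> p q = dist_rho \<rho> q p"
  by (simp add: dist_rho_def dist_commute)

lemma dist_fst_le_dist_rho: "dist (fst p) (fst q) \<le> dist_rho \<rho> p q"
  and dist_snd_le_dist_rho: "\<rho> * dist (snd p) (snd q) \<le> dist_rho \<rho> p q"
  by (auto simp: dist_rho_def)

text \<open>The carrier is arbitrary so that Ekeland's principle can be applied on a small
  box.\<close>

lemma Metric_space_dist_rho:
  fixes M :: "('a::metric_space \<times> 'b::metric_space) set"
  assumes "0 < \<rho>"
  shows "Metric_space M (dist_rho \<rho>)"
proof
  fix p q r :: "'a \<times> 'b"
  show "dist_rho \<rho> p q = 0 \<longleftrightarrow> p = q"
    using dist_rho_pos[OF assms, of p q] by (cases "p = q") (auto simp: dist_rho_def)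
  show "0 \<le> dist_rho \<rho> p q" by (simp add: dist_rho_def le_max_iff_disj)
  show "dist_rho \<rho> p q = dist_rho \<rho> q p" by (rule dist_rho_commute)
  show "dist_rho \<rho> p r \<le> dist_rho \<rho> p q + dist_rho \<rho> q r" by (rule dist_rho_triangle[OF assms])
qed

lemma limitin_dist_rho_imp_tendsto:
  assumes "0 < \<rho>" "limitin (Metric_space.mtopology M (dist_rho \<rho>)) \<sigma> p sequentially" "range \<sigma> \<subseteq> M"
  shows "\<sigma> \<longlonglongrightarrow> p"
proof -
  interpret Metric_space M "dist_rho \<rho>" by (rule Metric_space_dist_rho[OF assms(1)])
  have lim: "(\<lambda>n. dist_rho \<rho> (\<sigma> n) p) \<longlonglongrightarrow> 0"
    using assms(2) by (simp add: limitin_metric_dist_null)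
  have "(\<lambda>n. dist (fst (\<sigma> n)) (fst p)) \<longlonglongrightarrow> 0"
    by (rule tendsto_sandwich[OF _ _ tendsto_const lim]) (auto simp: dist_fst_le_dist_rho)
  moreover have "(\<lambda>n. \<rho> * dist (snd (\<sigma> n)) (snd p)) \<longlonglongrightarrow> 0"
    using assms(1)
    by (intro tendsto_sandwich[OF _ _ tendsto_const lim]) (auto simp: dist_snd_le_dist_rho)
  then have "(\<lambda>n. dist (snd (\<sigma> n)) (snd p)) \<longlonglongrightarrow> 0"
    using assms(1) by (simp add: tendsto_mult_left_iff[where l = 0, simplified])
  ultimately have "(\<lambda>n. (fst (\<sigma> n), snd (\<sigma> n))) \<longlonglongrightarrow> (fst p, snd p)"
    by (intro tendsto_Pair) (simp_all only: tendsto_dist_iff[symmetric])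
  then show ?thesis by simp
qed

lemma mcomplete_dist_rho:
  fixes A :: "'a::metric_space set" and B :: "'b::metric_space set"
  assumes \<rho>: "0 < \<rho>" and "complete A" "complete B"
  shows "Metric_space.mcomplete (A \<times> B) (dist_rho \<rho>)"
proof -
  interpret Metric_space "A \<times> B" "dist_rho \<rho>" by (rule Metric_space_dist_rho[OF \<rho>])
  show ?thesis
    unfolding mcomplete_def
  proof (intro allI impI)
    fix \<sigma> assume "MCauchy \<sigma>"
    then have ran: "range \<sigma> \<subseteq> A \<times> B"
      and C: "\<And>\<epsilon>. 0 < \<epsilon> \<Longrightarrow> \<exists>N. \<forall>m n. N \<le> m \<longrightarrow> N \<le> n \<longrightarrow> dist_rho \<rho> (\<sigma> m) (\<sigma> n) < \<epsilon>"
      by (auto simp: MCauchy_def)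
    have \<sigma>A: "\<forall>n. fst (\<sigma> n) \<in> A" and \<sigma>B: "\<forall>n. snd (\<sigma> n) \<in> B"
      using ran by (auto simp: image_subset_iff mem_Times_iff)
    have "Cauchy (\<lambda>n. fst (\<sigma> n))"
      unfolding Cauchy_def using C dist_fst_le_dist_rho by (metis le_less_trans)
    from completeE[OF \<open>complete A\<close> \<sigma>A this] obtain a
      where a: "a \<in> A" "(\<lambda>n. fst (\<sigma> n)) \<longlonglongrightarrow> a" by blast
    have "Cauchy (\<lambda>n. snd (\<sigma> n))"
      unfolding Cauchy_def
    proof (intro allI impI)
      fix \<epsilon> :: real assume "0 < \<epsilon>"
      then obtain N where N: "\<And>m n. N \<le> m \<Longrightarrow> N \<le> n \<Longrightarrow> dist_rho \<rho> (\<sigma> m) (\<sigma> n) < \<rho> * \<epsilon>"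
        using C[OF mult_pos_pos[OF \<rho>]] by blast
      have "dist (snd (\<sigma> m)) (snd (\<sigma> n)) < \<epsilon>" if "N \<le> m" "N \<le> n" for m n
      proof -
        have "\<rho> * dist (snd (\<sigma> m)) (snd (\<sigma> n)) < \<rho> * \<epsilon>"
          by (rule le_less_trans[OF dist_snd_le_dist_rho N[OF that]])
        then show ?thesis using \<rho> by simp
      qed
      then show "\<exists>N. \<forall>m\<ge>N. \<forall>n\<ge>N. dist (snd (\<sigma> m)) (snd (\<sigma> n)) < \<epsilon>" by blast
    qed
    from completeE[OF \<open>complete B\<close> \<sigma>B this] obtain b
      where b: "b \<in> B" "(\<lambda>n. snd (\<sigma> n)) \<longlonglongrightarrow> b" by blast
    have "(\<lambda>n. dist_rho \<rho> (\<sigma> n) (a, b)) \<longlonglongrightarrow> max 0 (\<rho> * 0)"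
      unfolding dist_rho_def fst_conv snd_conv
      by (intro tendsto_max tendsto_mult tendsto_const a(2)[THEN tendsto_dist_iff[THEN iffD1]]
          b(2)[THEN tendsto_dist_iff[THEN iffD1]])
    then show "\<exists>x. limitin mtopology \<sigma> x sequentially"
      using a b ran by (intro exI[of _ "(a, b)"]) (auto simp: limitin_metric_dist_null image_subset_iff)
  qed
qed

section \<open>Lower semicontinuity, the linear bound from (P2), and slope estimates\<close>

text \<open>\<open>lsc_at\<close> uses the punctured filter \<open>at p\<close>, but the sequence
  may hit p; there the bound is the assumption a < g p.\<close>

lemma lsc_at_sequentially:
  assumes "lsc_at g p" "\<sigma> \<longlonglongrightarrow> p" "a < g p"
  shows "eventually (\<lambda>n. a < g (\<sigma> n)) sequentially"
proof -
  have "eventually (\<lambda>q. a < g q) (at p)"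
    using assms by (intro less_LiminfD) (auto simp: lsc_at_def)
  then have "eventually (\<lambda>q. a < g q) (nhds p)"
    using assms(3) by (auto simp: eventually_at_filter elim!: eventually_mono)
  then show ?thesis
    using assms(2) unfolding filterlim_iff by blast
qed

text \<open>Any real k strictly between 0 and the lower limit works. The threshold \<open>b\<close>
  is an extended real and may be \<infinity>, so a real \<open>\<eta>\<close> is chosen below
  it.\<close>

lemma cond_P2_linear_bound:
  assumes "cond_P2 f yb"
  obtains k \<eta> where "0 < k" "0 < \<eta>"
    "\<And>p F. f p = ereal F \<Longrightarrow> 0 < F \<Longrightarrow> F < \<eta> \<Longrightarrow> k * dist (snd p) yb < F"
proof -
  obtain k where k: "0 < ereal k"
    "ereal k < Liminf (filtercomap f (at_right 0)) (\<lambda>p. f p / ereal (dist (snd p) yb))"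
    using assms ereal_dense2 unfolding cond_P2_def by blast
  from less_LiminfD[OF k(2)] obtain b where b: "0 < b"
    "\<And>p. 0 < f p \<Longrightarrow> f p < b \<Longrightarrow> ereal k < f p / ereal (dist (snd p) yb)"
    unfolding eventually_filtercomap by (auto simp: eventually_at_right[of 0 1])
  obtain \<eta> where \<eta>: "0 < ereal \<eta>" "ereal \<eta> < b" using ereal_dense2[OF b(1)] by blast
  show ?thesis
  proof
    show "0 < k" "0 < \<eta>" using k \<eta> by auto
    fix p F assume F: "f p = ereal F" "0 < F" "F < \<eta>"
    then have "f p < b" using \<eta> by (metis less_ereal.simps(1) less_trans)
    then show "k * dist (snd p) yb < F"
      using b(2)[of p] F ereal_less_divide_iff[of "f p" "dist (snd p) yb" k] by simp
  qed
qed

lemma nonlocal_slope_geI: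
  assumes "q \<noteq> p" "0 < \<rho>" "f q \<le> 0" "ereal (c * dist_rho \<rho> p q) \<le> f p" "0 < f p"
  shows "ereal c \<le> nonlocal_slope \<rho> f p"
proof -
  have "0 < dist_rho \<rho> p q" using assms by (intro dist_rho_pos) auto
  then have "ereal c \<le> max (f p - max (f q) 0) 0 / ereal (dist_rho \<rho> p q)"
    using assms by (cases "f p") (auto simp: max_def field_simps)
  also have "\<dots> \<le> nonlocal_slope \<rho> f p"
    unfolding nonlocal_slope_def using assms by (intro SUP_upper) auto
  finally show ?thesis .
qed

text \<open>Finiteness of f p matters: if f p and f q are both \<infinity>, the assumed estimate
  holds at q, yet f p - f q is \<infinity> in \<open>ereal\<close>.\<close>

lemma nonlocal_slope_leI:
  assumes "0 < \<rho>" "0 \<le> c" "f p = ereal F"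
    and "\<And>q. q \<noteq> p \<Longrightarrow> f p \<le> max (f q) 0 + ereal (c * dist_rho \<rho> p q)"
  shows "nonlocal_slope \<rho> f p \<le> ereal c"
  unfolding nonlocal_slope_def
proof (rule SUP_least)
  fix q assume "q \<in> {q. q \<noteq> p}"
  then have q: "q \<noteq> p" by blast
  have pos: "0 < dist_rho \<rho> p q" using assms q by (intro dist_rho_pos) auto
  have "0 \<le> max (f q) 0" by simp
  then have "max (f p - max (f q) 0) 0 \<le> ereal (c * dist_rho \<rho> p q)"
    using assms(4)[OF q] assms(2,3) pos by (cases "max (f q) 0") auto
  then show "max (f p - max (f q) 0) 0 / ereal (dist_rho \<rho> p q) \<le> ereal c"
    using pos by (simp add: ereal_divide_le_pos mult.commute)
qed

lemma uniform_strict_slope_geI: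
  assumes "0 < \<rho>\<^sub>0" and "\<And>\<rho> p. 0 < \<rho> \<Longrightarrow> \<rho> < \<rho>\<^sub>0 \<Longrightarrow> dist (fst p) (fst pb) < \<rho> \<Longrightarrow> 0 < f p \<Longrightarrow>
    f p < ereal \<rho> \<Longrightarrow> a \<le> nonlocal_slope \<rho> f p"
  shows "a \<le> uniform_strict_slope f pb"
proof (rule tendsto_lowerbound[OF tendsto_uniform_strict_slope])
  show "eventually (\<lambda>\<rho>. a \<le> inf_nonlocal_slope f pb \<rho>) (at_right 0)"
    unfolding eventually_at_right_field inf_nonlocal_slope_def
    using assms by (intro exI[of _ \<rho>\<^sub>0]) (auto intro!: INF_greatest)
qed simp

lemma eventually_error_bound_filter:
  "eventually P (inf (filtercomap fst (nhds x)) (principal {p. f p > (0::ereal)})) \<longleftrightarrow>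
    (\<exists>\<delta>>0. \<forall>p. dist (fst p) x < \<delta> \<longrightarrow> 0 < f p \<longrightarrow> P p)"
  (is "?L \<longleftrightarrow> ?R") for x :: "'a::metric_space" and f :: "'a \<times> 'b \<Rightarrow> ereal"
proof
  assume ?L
  then show ?R
    unfolding eventually_inf_principal eventually_filtercomap eventually_nhds_metric mem_Collect_eq
    by blast
next
  assume ?R
  then obtain \<delta> where "0 < \<delta>" "\<forall>p. dist (fst p) x < \<delta> \<longrightarrow> 0 < f p \<longrightarrow> P p" by blast
  then show ?L
    unfolding eventually_inf_principal eventually_filtercomap eventually_nhds_metric mem_Collect_eq
    by (intro exI[of _ "\<lambda>z. dist z x < \<delta>"]) blast
qed

lemma error_bound_modulus_nonneg: "0 \<le> error_bound_modulus f pb"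
  unfolding error_bound_modulus_def
  by (intro Liminf_bounded)
    (simp add: eventually_inf_principal zero_le_divide_ereal infdist_nonneg less_imp_le)

text \<open>The second point q is essential, since a supremum over the empty set is
  -\<infinity>.\<close>

lemma nonlocal_slope_nonneg:
  assumes "q \<noteq> p" "0 < \<rho>"
  shows "0 \<le> nonlocal_slope \<rho> f p"
proof -
  have "0 < dist_rho \<rho> p q" using assms by (intro dist_rho_pos) auto
  then have "0 \<le> max (f p - max (f q) 0) 0 / ereal (dist_rho \<rho> p q)"
    by (intro zero_le_divide_ereal) auto
  also have "\<dots> \<le> nonlocal_slope \<rho> f p"
    unfolding nonlocal_slope_def using assms by (intro SUP_upper) auto
  finally show ?thesis .
qed

section \<open>Er f is at most the uniform strict slope\<close>

lemma error_bound_modulus_le_uniform_strict_slope: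
  assumes zero: "f (xb, yb) = 0" and P1: "cond_P1 f yb" and P2: "cond_P2 f yb"
  shows "error_bound_modulus f (xb, yb) \<le> uniform_strict_slope f (xb, yb)"
proof (rule dense_le)
  fix a assume a: "a < error_bound_modulus f (xb, yb)"
  show "a \<le> uniform_strict_slope f (xb, yb)"
  \<comment> \<open>For a \<le> 0 nonnegativity of the slopes suffices, with (xb, yb) as the second
    point. A positive a is a real c, by which one may divide.\<close>
  proof (cases "0 < a")
    case False
    show ?thesis
    proof (rule uniform_strict_slope_geI[OF zero_less_one])
      fix \<rho> :: real and p assume "0 < \<rho>" "0 < f p"
      then have "0 \<le> nonlocal_slope \<rho> f p"
        using zero by (intro nonlocal_slope_nonneg[of "(xb, yb)"]) auto
      with False show "a \<le> nonlocal_slope \<rho> f p" by simp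
    qed
  next
    case True
    with a obtain c where c: "a = ereal c" "0 < c" by (cases a) auto
    let ?S = "zero_sublevel f"
    have "xb \<in> ?S" using zero by (auto simp: zero_sublevel_def intro: exI[of _ yb])
    then have S: "?S \<noteq> {}" by blast
    obtain k \<eta> where k: "0 < k" "0 < \<eta>"
      "\<And>p F. f p = ereal F \<Longrightarrow> 0 < F \<Longrightarrow> F < \<eta> \<Longrightarrow> k * dist (snd p) yb < F"
      using cond_P2_linear_bound[OF P2] by blast
    obtain \<delta> where \<delta>: "0 < \<delta>"
      "\<And>p. dist (fst p) xb < \<delta> \<Longrightarrow> 0 < f p \<Longrightarrow> ereal c < f p / ereal (infdist (fst p) ?S)"
      using less_LiminfD[OF a[unfolded error_bound_modulus_def c(1)]]
      by (auto simp: eventually_error_bound_filter)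
    show ?thesis
    proof (rule uniform_strict_slope_geI)
      \<comment> \<open>Here \<open>\<delta>\<close> serves the error bound and
        \<open>\<eta>\<close> serves (P2); \<rho> < k / c gives c \<rho> d(y, yb) \<le> k d(y, yb) <
        F, which handles the second coordinate of \<open>dist_rho\<close>.\<close>
      show "0 < min \<delta> (min \<eta> (k / c))" using \<delta> k c by simp
      fix \<rho> :: real and p
      assume \<rho>: "0 < \<rho>" "\<rho> < min \<delta> (min \<eta> (k / c))"
        and p: "dist (fst p) (fst (xb, yb)) < \<rho>" "0 < f p" "f p < ereal \<rho>"
      obtain F where F: "f p = ereal F" "0 < F" "F < \<rho>" using p by (cases "f p") auto
      have "ereal c < f p / ereal (infdist (fst p) ?S)" using \<delta>(2) p \<rho> by simp
      then have "c * infdist (fst p) ?S < F"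
        using F ereal_less_divide_iff[of "f p" "infdist (fst p) ?S" c] by (simp add: infdist_nonneg)
      then have "infdist (fst p) ?S < F / c" using c by (simp add: field_simps)
      then obtain u where u: "u \<in> ?S" "dist (fst p) u < F / c"
        using S by (auto simp: infdist_notempty cINF_less_iff)
      then obtain v where "f (u, v) \<le> 0" by (auto simp: zero_sublevel_def)
      \<comment> \<open>(P2) controls only the distance from y to yb, so the zero above u has to be
        the one at yb.\<close>
      with P1 have fu: "f (u, yb) \<le> 0" unfolding cond_P1_def by (metis not_le)
      have "k * dist (snd p) yb < F" using k(3)[of p F] F \<rho> by simp
      moreover have "c * \<rho> \<le> k" using \<rho> c by (simp add: field_simps)
      then have "c * \<rho> * dist (snd p) yb \<le> k * dist (snd p) yb"
        by (intro mult_right_mono) auto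
      ultimately have "c * dist_rho \<rho> p (u, yb) \<le> F"
        using u c by (auto simp: dist_rho_def max_def field_simps)
      then show "a \<le> nonlocal_slope \<rho> f p"
        unfolding c(1) using fu p F \<rho> by (intro nonlocal_slope_geI[of "(u, yb)"]) auto
    qed
  qed
qed

section \<open>The uniform strict slope is at most Er f\<close>

lemma uniform_strict_slope_le_error_bound_modulus:
  fixes f :: "'a::metric_space \<times> 'b::metric_space \<Rightarrow> ereal"
  assumes zero: "f (xb, yb) = 0" and P2: "cond_P2 f yb"
    and complete: "complete (UNIV :: 'a set)" "complete (UNIV :: 'b set)"
    and lsc: "eventually (lsc_at (\<lambda>p. max (f p) 0)) (nhds (xb, yb))"
  shows "uniform_strict_slope f (xb, yb) \<le> error_bound_modulus f (xb, yb)"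
proof (rule ccontr)
  assume "\<not> ?thesis"
  then have "error_bound_modulus f (xb, yb) < uniform_strict_slope f (xb, yb)" by simp
  from ereal_dense2[OF this] obtain c where c_gt: "error_bound_modulus f (xb, yb) < ereal c"
    and c_lt: "ereal c < uniform_strict_slope f (xb, yb)"
    by blast
  have c: "0 < c"
    using le_less_trans[OF error_bound_modulus_nonneg c_gt] by simp
  let ?S = "zero_sublevel f" and ?g = "\<lambda>p. max (f p) 0"
  have xbS: "xb \<in> ?S" using zero by (auto simp: zero_sublevel_def intro: exI[of _ yb])
  obtain k \<eta> where k: "0 < k" "0 < \<eta>"
    "\<And>p F. f p = ereal F \<Longrightarrow> 0 < F \<Longrightarrow> F < \<eta> \<Longrightarrow> k * dist (snd p) yb < F"
    using cond_P2_linear_bound[OF P2] by blast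
  have "eventually (\<lambda>\<rho>. ereal c < inf_nonlocal_slope f (xb, yb) \<rho>) (at_right 0)"
    by (rule order_tendstoD(1)[OF tendsto_uniform_strict_slope c_lt])
  \<comment> \<open>From here on \<rho> is fixed; all further smallness is put into
    \<open>\<delta>\<close>, which may depend on it.\<close>
  then obtain \<rho> where \<rho>: "0 < \<rho>" "ereal c < inf_nonlocal_slope f (xb, yb) \<rho>"
    unfolding eventually_at_right_field using dense by blast
  obtain U where "open U" "(xb, yb) \<in> U" and U: "\<And>p. p \<in> U \<Longrightarrow> lsc_at ?g p"
    using lsc unfolding eventually_nhds by blast
  then obtain A B where AB: "open A" "open B" "xb \<in> A" "yb \<in> B" "A \<times> B \<subseteq> U"
    by (metis mem_Sigma_iff open_prod_elim)
  obtain r1 r2 where r12: "0 < r1" "cball xb r1 \<subseteq> A" "0 < r2" "cball yb r2 \<subseteq> B"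
    using AB by (meson open_contains_cball)
  define r where "r = min r1 r2"
  define M where "M = cball xb r \<times> cball yb r"
  have r: "0 < r" "\<And>p. p \<in> M \<Longrightarrow> lsc_at ?g p"
    using r12 AB U unfolding r_def M_def by (auto simp: subset_iff)
  interpret M: Metric_space M "dist_rho \<rho>" by (rule Metric_space_dist_rho[OF \<rho>(1)])
  have mcomplete: "M.mcomplete"
    unfolding M_def
    using complete[THEN complete_Int_closed, OF closed_cball] \<rho>(1)
    by (intro mcomplete_dist_rho) simp_all

  \<comment> \<open>The three summands of D serve three bounds. From 3 \<delta> \<le> min r \<rho>,
    a first coordinate within 2 \<delta> of xb stays \<delta> inside the box and within \<rho>. From
    c \<delta> \<le> min \<eta> \<rho>, values below c \<delta> are in the range of (P2) and below
    \<rho>. From (2 + \<rho> c / k) \<delta> \<le> \<rho> r, the second coordinate keeps a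
    \<rho>-weighted margin \<delta> after (P2) costs \<rho> c \<delta> / k and the Ekeland move
    costs \<delta>.\<close>
  define D where "D = 3 + c + \<rho> * c / k"
  define \<delta> where "\<delta> = min (min r \<eta>) (min \<rho> (\<rho> * r)) / D"
  have D: "3 \<le> D" "c \<le> D" "2 + \<rho> * c / k \<le> D" using c \<rho> k by (auto simp: D_def)
  have \<delta>: "0 < \<delta>" using r k \<rho> D by (simp add: \<delta>_def)
  have D\<delta>: "D * \<delta> = min (min r \<eta>) (min \<rho> (\<rho> * r))" using D by (simp add: \<delta>_def)
  have \<delta>3: "3 * \<delta> \<le> D * \<delta>" and \<delta>c: "c * \<delta> \<le> D * \<delta>" and \<delta>k: "(2 + \<rho> * c / k) * \<delta> \<le> D * \<delta>"
    using D \<delta> by (auto intro!: mult_right_mono)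

  have "\<exists>p. dist (fst p) xb < \<delta> \<and> 0 < f p \<and> f p / ereal (infdist (fst p) ?S) < ereal c"
  proof (rule ccontr)
    assume "\<not> ?thesis"
    then have "ereal c \<le> error_bound_modulus f (xb, yb)"
      unfolding error_bound_modulus_def fst_conv using \<delta>
      by (intro Liminf_bounded, unfold eventually_error_bound_filter) (meson not_less)
    with c_gt show False by simp
  qed
  then obtain x y where p: "dist x xb < \<delta>" "0 < f (x, y)"
    "f (x, y) / ereal (infdist x ?S) < ereal c"
    by auto
  define s where "s = infdist x ?S"
  have s: "0 \<le> s" "s < \<delta>"
    using infdist_le[OF xbS, of x] p unfolding s_def by (auto simp: infdist_nonneg)
  \<comment> \<open>At s = 0 the quotient would be \<infinity>, not below c.\<close>
  have "s \<noteq> 0" using p by (cases "f (x, y)") (auto simp: s_def[symmetric] divide_ereal_def)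
  then have s_pos: "0 < s" using s by simp
  then obtain F where F: "f (x, y) = ereal F" "0 < F" "F < c * s"
    using p unfolding s_def[symmetric] by (cases "f (x, y)") (auto simp: field_simps)
  have "c * s < c * \<delta>" using s c by simp
  then have F_less: "F < c * \<delta>" using F by simp
  have "k * dist y yb < F" using k(3)[of "(x, y)" F] F F_less D\<delta> \<delta>c by simp
  then have y: "dist y yb < c * \<delta> / k" using F_less k by (simp add: field_simps)
  have "\<rho> * (c * \<delta> / k) \<le> \<rho> * r - 2 * \<delta>" using D\<delta> \<delta>k by (simp add: algebra_simps)
  then have "\<rho> * dist y yb < \<rho> * r - 2 * \<delta>"
    using y \<rho>(1) by (smt (verit) mult_strict_left_mono)
  note y' = this
  then have "dist y yb < r" using \<delta> \<rho>(1) by (smt (verit) mult_less_cancel_left_pos)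
  then have pM: "(x, y) \<in> M" using p D\<delta> \<delta>3 \<delta> by (auto simp: M_def dist_commute)

  obtain q where qM: "q \<in> M" and q: "?g q + ereal (c * dist_rho \<rho> (x, y) q) \<le> ?g (x, y)"
    and q_min: "\<And>w. w \<in> M \<Longrightarrow> w \<noteq> q \<Longrightarrow> ?g q < ?g w + ereal (c * dist_rho \<rho> q w)"
  proof (rule M.ekeland_variational_principle[OF mcomplete c, of ?g "(x, y)"])
    fix \<sigma> w a
    assume lim: "limitin M.mtopology \<sigma> w sequentially" and "range \<sigma> \<subseteq> M" and "a < ?g w"
    moreover from lim have "w \<in> M" by (simp add: M.limitin_metric)
    ultimately show "eventually (\<lambda>n. a < ?g (\<sigma> n)) sequentially"
      by (intro lsc_at_sequentially[of ?g] r(2) limitin_dist_rho_imp_tendsto[OF \<rho>(1)])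
  qed (use pM F in auto)
  have gp: "?g (x, y) = ereal F" using F by simp
  obtain G where G: "?g q = ereal G" "0 \<le> G" "G + c * dist_rho \<rho> (x, y) q \<le> F"
  proof -
    have "0 \<le> ?g q" by simp
    with q that show ?thesis unfolding gp by (cases "?g q") auto
  qed
  \<comment> \<open>The drop from F to G \<ge> 0 at rate c bounds the displacement by F / c, which
    is less than s.\<close>
  have "c * dist_rho \<rho> (x, y) q < c * s" using G F by simp
  then have d_q: "dist_rho \<rho> (x, y) q < s" using c by simp
  then have xq: "dist x (fst q) < s" and yq: "\<rho> * dist y (snd q) < s"
    using dist_fst_le_dist_rho[of "(x, y)" q \<rho>] dist_snd_le_dist_rho[of \<rho> "(x, y)" q] by auto
  have "fst q \<notin> ?S" using infdist_le[of "fst q" ?S x] xq by (auto simp: s_def)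
  then have "\<not> f (fst q, snd q) \<le> 0" unfolding zero_sublevel_def by blast
  then have fq_pos: "0 < f q" by simp
  then have fq: "f q = ereal G" using G by (simp add: max_def split: if_splits)
  have "0 \<le> c * dist_rho \<rho> (x, y) q" using c by simp
  then have GF: "G \<le> F" using G by simp
  have xq': "dist (fst q) xb < 2 * \<delta>"
    using dist_triangle[of "fst q" xb x] xq s p by (simp add: dist_commute)
  have "\<rho> * dist (snd q) yb \<le> \<rho> * dist y (snd q) + \<rho> * dist y yb"
    using \<rho>(1) dist_triangle3[of "snd q" yb y]
    by (simp add: distrib_left[symmetric] dist_commute)
  then have yq': "\<rho> * dist (snd q) yb < \<rho> * r - \<delta>" using yq s y' by simp

  have "nonlocal_slope \<rho> f q \<le> ereal c"
  proof (rule nonlocal_slope_leI[where f = f, OF \<rho>(1) less_imp_le[OF c] fq])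
    fix w assume "w \<noteq> q"
    show "f q \<le> ?g w + ereal (c * dist_rho \<rho> q w)"
    proof (cases "w \<in> M")
      case True
      then show ?thesis using q_min[OF True \<open>w \<noteq> q\<close>] fq G by simp
    next
      \<comment> \<open>Ekeland's estimate does not reach w here. The margin of q gives c
        \<open>dist_rho \<rho> q w\<close> \<ge> c \<delta>, which already exceeds F \<ge> f
        q.\<close>
      case False
      then consider "r < dist (fst w) xb" | "r < dist (snd w) yb"
        by (cases w) (auto simp: M_def dist_commute)
      then have "\<delta> \<le> dist_rho \<rho> q w"
      proof cases
        case 1
        then show ?thesis
          using dist_triangle[of "fst w" xb "fst q"] xq' D\<delta> \<delta>3 dist_fst_le_dist_rho[of q w \<rho>]
          by (simp add: dist_commute)
      next
        case 2
        then have "\<rho> * r \<le> \<rho> * (dist (snd q) (snd w) + dist (snd q) yb)"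
          using dist_triangle[of "snd w" yb "snd q"] \<rho>(1) by (simp add: dist_commute)
        then show ?thesis
          using yq' dist_snd_le_dist_rho[of \<rho> q w] by (simp add: distrib_left)
      qed
      then have "c * \<delta> \<le> c * dist_rho \<rho> q w" using c by simp
      then have "G \<le> c * dist_rho \<rho> q w" using GF F_less by simp
      then have "f q \<le> 0 + ereal (c * dist_rho \<rho> q w)" by (simp add: fq)
      also have "\<dots> \<le> ?g w + ereal (c * dist_rho \<rho> q w)" by (intro add_right_mono) simp
      finally show ?thesis .
    qed
  qed
  moreover have "inf_nonlocal_slope f (xb, yb) \<rho> \<le> nonlocal_slope \<rho> f q"
    unfolding inf_nonlocal_slope_def
  proof (rule INF_lower)
    show "q \<in> {p. dist (fst p) (fst (xb, yb)) < \<rho> \<and> 0 < f p \<and> f p < ereal \<rho>}"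
      using xq' fq_pos fq GF F_less D\<delta> \<delta>3 \<delta>c \<delta> by auto
  qed
  ultimately show False using \<rho>(2) by (meson leD order_trans)
qed

theorem theorem4p1:
  fixes f :: "'a::metric_space \<times> 'b::metric_space \<Rightarrow> ereal" and xb :: 'a and yb :: 'b
  assumes "\<And>p. f p \<noteq> -\<infinity>"
    and "f (xb, yb) = 0"
    and "cond_P1 f yb"
    and "cond_P2 f yb"
  shows "error_bound_modulus f (xb, yb) \<le> uniform_strict_slope f (xb, yb) \<and>
         (complete (UNIV :: 'a set) \<and> complete (UNIV :: 'b set) \<and>
          eventually (lsc_at (\<lambda>p. max (f p) 0)) (nhds (xb, yb)) \<longrightarrow>
          error_bound_modulus f (xb, yb) = uniform_strict_slope f (xb, yb))"
  using error_bound_modulus_le_uniform_strict_slope[OF assms(2-4)]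
    uniform_strict_slope_le_error_bound_modulus[OF assms(2,4)]
  by (auto intro: antisym)

end
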